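(* Let $U$ be a nonempty finite set and let $\mathcal{F} \subseteq 2^U$ be an ideal family on $U$. Then the normalized degree sum of $\mathcal{F}$ is non-positive: $$\mathrm{NDS}(\mathcal{F}) \leq 0.$$ Consequently, every ideal family satisfies the average rarity condition.
   Context: Let $U$ be a nonempty finite set (the ground set); its elements are called vertices. A set family $\mathcal{F}$ on $U$ is a collection of subsets of $U$; its members are called hyperedges. A set family $\mathcal{F} \subseteq 2^U$ is an ideal family on $U$ if: (1) $\emptyset \in \mathcal{F}$; (2) $U \in \mathcal{F}$; (3) (downward-closed except $U$) for every $A \in \mathcal{F}$ with $A \neq U$ and every $B \subseteq A$, one has $B \in \mathcal{F}$. For $v \in U$, the degree of $v$ in $\mathcal{F}$ is $\deg_{\mathcal{F}}(v) = |\{H \in \mathcal{F} \mid v \in H\}|$. The normalized degree sum (an integer) is $$\mathrm{NDS}(\mathcal{F}) = 2 \cdot \sum_{v \in U} \deg_{\mathcal{F}}(v) - |U| \cdot |\mathcal{F}|.$$ $\mathcal{F}$ satisfies the average rarity condition if $\mathrm{NDS}(\mathcal{F}) \leq 0$. *)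

theory Defs
  imports Main
begin

definition set_family :: "'a set \<Rightarrow> 'a set set \<Rightarrow> bool" where
  "set_family U F \<longleftrightarrow> F \<subseteq> Pow U"

definition ideal_family :: "'a set \<Rightarrow> 'a set set \<Rightarrow> bool" where
  "ideal_family U F \<longleftrightarrow>
     set_family U F \<and> {} \<in> F \<and> U \<in> F \<and>
     (\<forall>A\<in>F. A \<noteq> U \<longrightarrow> (\<forall>B. B \<subseteq> A \<longrightarrow> B \<in> F))"

definition degree :: "'a set set \<Rightarrow> 'a \<Rightarrow> nat" where
  "degree F v = card {H \<in> F. v \<in> H}"

(* Integer-valued, so that the subtraction is not truncated. *)
definition NDS :: "'a set \<Rightarrow> 'a set set \<Rightarrow> int" where
  "NDS U F = 2 * (\<Sum>v\<in>U. int (degree F v)) - int (card U) * int (card F)"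

definition average_rarity :: "'a set \<Rightarrow> 'a set set \<Rightarrow> bool" where
  "average_rarity U F \<longleftrightarrow> NDS U F \<le> 0"

end

theory Submission
  imports Defs
begin

text \<open>
  Put \<open>I = F - {U}\<close>, a nonempty down-set of the cube \<open>Pow U\<close> missing \<open>U\<close>. Matching \<open>H\<close> with
  \<open>insert v H\<close> shows that \<open>NDS U F\<close> is \<open>card U\<close> minus the number of cube edges leaving \<open>I\<close>, so
  it suffices to find \<open>card U\<close> such edges. Take a maximal member \<open>A\<close> of \<open>I\<close> and some \<open>u \<in> U - A\<close>.
  Every \<open>v \<in> U - A\<close> gives the edge from \<open>A\<close> to \<open>insert v A\<close>; every \<open>v \<in> A\<close> gives an edge on the path
  from \<open>A - {v}\<close> through \<open>insert u (A - {v})\<close> to \<open>insert u A\<close>. These edges are distinct, since the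
  lower endpoint \<open>H\<close> satisfies \<open>H \<inter> A = A - {v}\<close>.
\<close>

text \<open>Lower endpoints of the cube edges in direction \<open>v\<close> that leave
  \<open>I\<close>.\<close>

definition up_boundary :: "'a set set \<Rightarrow> 'a \<Rightarrow> 'a set set" where
  "up_boundary I v = {H \<in> I. v \<notin> H \<and> insert v H \<notin> I}"

lemma card_down_set_split:
  assumes fin: "finite I"
    and down: "\<And>A B. A \<in> I \<Longrightarrow> B \<subseteq> A \<Longrightarrow> B \<in> I"
  shows "card I = 2 * degree I v + card (up_boundary I v)"
proof -
  let ?P = "{H \<in> I. v \<in> H}" and ?Q = "{H \<in> I. v \<notin> H \<and> insert v H \<in> I}"
  have "bij_betw (insert v) ?Q ?P"
    by (rule bij_betw_byWitness[where f' = "\<lambda>H. H - {v}"])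
      (auto simp: insert_absorb intro: down)
  then have eq: "card ?Q = card ?P"
    by (rule bij_betw_same_card)
  have "I = ?P \<union> (?Q \<union> up_boundary I v)"
    by (auto simp: up_boundary_def)
  then have "card I = card (?P \<union> (?Q \<union> up_boundary I v))"
    by simp
  also have "\<dots> = card ?P + card (?Q \<union> up_boundary I v)"
    using fin by (intro card_Un_disjoint) (auto simp: up_boundary_def)
  also have "card (?Q \<union> up_boundary I v) = card ?Q + card (up_boundary I v)"
    using fin by (intro card_Un_disjoint) (auto simp: up_boundary_def)
  finally show ?thesis
    using eq by (simp add: degree_def)
qed

lemma card_le_up_boundary:
  assumes U: "finite U" and I: "I \<subseteq> Pow U" "I \<noteq> {}" "U \<notin> I"
    and down: "\<And>A B. A \<in> I \<Longrightarrow> B \<subseteq> A \<Longrightarrow> B \<in> I"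
  shows "card U \<le> (\<Sum>v\<in>U. card (up_boundary I v))"
proof -
  have finI: "finite I"
    using U I(1) by (meson finite_Pow_iff finite_subset)
  obtain A where A: "A \<in> I" and max: "\<And>B. B \<in> I \<Longrightarrow> A \<subseteq> B \<Longrightarrow> B = A"
    using finite_has_maximal[OF finI I(2)] by metis
  obtain u where u: "u \<in> U" "u \<notin> A"
    using A I by (metis PowD subsetD subsetI subset_antisym)
  have out: "insert w A \<notin> I" if "w \<notin> A" for w
    using max that by blast
  have sub: "A - {v} \<in> I" for v
    using A down by blast
  \<comment> \<open>\<open>f v\<close> encodes an edge as (direction, lower endpoint). For
    \<open>v \<in> A\<close> the path starts in \<open>I\<close> and ends outside it, so when its
    first edge stays in \<open>I\<close>, its second one leaves.\<close>
  define f where "f v = (if v \<notin> A then (v, A)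
      else if insert u (A - {v}) \<notin> I then (u, A - {v})
      else (v, insert u (A - {v})))" for v
  have "snd (f v) \<inter> A = A - {v}" for v
    using u by (auto simp: f_def)
  moreover have "fst (f v) = v" if "v \<notin> A" for v
    using that by (simp add: f_def)
  \<comment> \<open>Equal images give \<open>A - {v} = A - {w}\<close>, which forces
    \<open>v = w\<close> unless both lie outside \<open>A\<close>; there the directions
    decide.\<close>
  ultimately have "inj_on f U"
    by (intro inj_onI) (metis Diff_insert_absorb Diff_iff insertI1 insert_Diff insert_iff)
  moreover have "f v \<in> (SIGMA v:U. up_boundary I v)" if "v \<in> U" for v
  proof (cases "v \<in> A")
    case True
    then have "insert v (insert u (A - {v})) = insert u A"
      by blast
    then show ?thesis
      using True that u out sub by (auto simp: f_def up_boundary_def)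
  next
    case False
    then show ?thesis
      using that A out by (simp add: f_def up_boundary_def)
  qed
  moreover have fin: "finite (up_boundary I v)" for v
    using finI by (simp add: up_boundary_def)
  ultimately have "card U \<le> card (SIGMA v:U. up_boundary I v)"
    using U by (intro card_inj_on_le[of f] image_subsetI finite_SigmaI)
  then show ?thesis
    using U fin by (simp add: card_SigmaI)
qed

theorem theorem4p1:
  fixes U :: "'a set" and F :: "'a set set"
  assumes "finite U" and "U \<noteq> {}" and "ideal_family U F"
  shows "NDS U F \<le> 0 \<and> average_rarity U F"
proof -
  define I where "I = F - {U}"
  have F: "F = insert U I" "U \<notin> I" and IU: "I \<subseteq> Pow U" and ne: "I \<noteq> {}"
    using assms by (auto simp: I_def ideal_family_def set_family_def)
  have down: "B \<in> I" if "A \<in> I" "B \<subseteq> A" for A B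
    using that assms(3) unfolding I_def ideal_family_def set_family_def by blast
  have fin: "finite I"
    using assms(1) IU by (meson finite_Pow_iff finite_subset)
  have cF: "card F = Suc (card I)"
    using F fin by simp
  \<comment> \<open>The \<open>1\<close> comes from the member \<open>U\<close>, which adds 2 to
    twice the degree and 1 to \<open>card F\<close>.\<close>
  have summand: "2 * int (degree F v) - int (card F) = 1 - int (card (up_boundary I v))"
    if "v \<in> U" for v
  proof -
    have "{H \<in> F. v \<in> H} = insert U {H \<in> I. v \<in> H}"
      using F(1) that by auto
    then have "degree F v = Suc (degree I v)"
      using F(2) fin by (simp add: degree_def)
    moreover have "card I = 2 * degree I v + card (up_boundary I v)"
      using fin by (rule card_down_set_split) (rule down)
    ultimately show ?thesis
      using cF by simp
  qed
  have edges: "card U \<le> (\<Sum>v\<in>U. card (up_boundary I v))"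
    by (rule card_le_up_boundary[OF assms(1) IU ne F(2)]) (rule down)
  have "NDS U F = (\<Sum>v\<in>U. 2 * int (degree F v) - int (card F))"
    by (simp add: NDS_def sum_subtractf sum_distrib_left)
  also have "\<dots> = int (card U) - int (\<Sum>v\<in>U. card (up_boundary I v))"
    by (simp add: summand sum_subtractf)
  also have "\<dots> \<le> 0"
    using edges by (simp only: diff_le_0_iff_le of_nat_le_iff)
  finally show ?thesis
    by (simp add: average_rarity_def)
qed

end
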